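(* Let $E_1=\mathbb{R}$, $E_2=\mathbb{R}$. There exist sequences $(X_n)$ and $(Y_n)$ of real random variables (defined on one probability space) satisfying AI-3 but not AI-1.
   Context: $P_\xi$ denotes the distribution of $\xi$; $\mathbb{R}$ carries its usual metric and Borel $\sigma$-algebra $\mathcal{B}(\mathbb{R})$, and $\mathbb{R}\times\mathbb{R}$ the sum (equivalently, maximum) metric. AI-1: for all bounded uniformly continuous functions $h:\mathbb{R}\times\mathbb{R}\to\mathbb{R}$, $\int h\,dP_{(X_n,Y_n)}-\int h\,d(P_{X_n}\times P_{Y_n})\to 0$ as $n\to+\infty$. AI-3: $\sup_{A,B\in\mathcal{B}(\mathbb{R})}|P_{(X_n,Y_n)}(A\times B)-P_{X_n}(A)P_{Y_n}(B)|\to 0$ as $n\to+\infty$. *)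

theory Defs
  imports "HOL-Probability.Probability"
begin

definition AI1 :: "'a measure \<Rightarrow> (nat \<Rightarrow> 'a \<Rightarrow> real) \<Rightarrow> (nat \<Rightarrow> 'a \<Rightarrow> real) \<Rightarrow> bool" where
  "AI1 M X Y \<longleftrightarrow>
    (\<forall>h :: real \<times> real \<Rightarrow> real.
       bounded (range h) \<and> uniformly_continuous_on UNIV h \<longrightarrow>
       (\<lambda>n. (\<integral>z. h z \<partial>distr M (borel \<Otimes>\<^sub>M borel) (\<lambda>\<omega>. (X n \<omega>, Y n \<omega>)))
          - (\<integral>z. h z \<partial>(distr M borel (X n) \<Otimes>\<^sub>M distr M borel (Y n))))
       \<longlonglongrightarrow> 0)"

(* The supremum ranges over a nonempty set of reals, and it is bounded (by 1) when M is a
   probability measure and all X n, Y n are measurable, so it is a genuine supremum there. *)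
definition AI3 :: "'a measure \<Rightarrow> (nat \<Rightarrow> 'a \<Rightarrow> real) \<Rightarrow> (nat \<Rightarrow> 'a \<Rightarrow> real) \<Rightarrow> bool" where
  "AI3 M X Y \<longleftrightarrow>
    (\<lambda>n. SUP (A, B) \<in> sets borel \<times> sets borel.
       \<bar>measure (distr M (borel \<Otimes>\<^sub>M borel) (\<lambda>\<omega>. (X n \<omega>, Y n \<omega>))) (A \<times> B)
        - measure (distr M borel (X n)) A * measure (distr M borel (Y n)) B\<bar>)
    \<longlonglongrightarrow> 0"

(* The library metric on real \<times> real is Euclidean; it gives the same uniformly continuous
   functions as the sum metric. *)
lemma uniformly_continuous_on_sum_metric:
  fixes h :: "real \<times> real \<Rightarrow> real"
  shows "uniformly_continuous_on UNIV h \<longleftrightarrow>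
    (\<forall>e>0. \<exists>d>0. \<forall>x y x' y'. dist x x' + dist y y' < d \<longrightarrow> dist (h (x, y)) (h (x', y')) < e)"
proof
  assume uc: "uniformly_continuous_on UNIV h"
  show "\<forall>e>0. \<exists>d>0. \<forall>x y x' y'. dist x x' + dist y y' < d \<longrightarrow> dist (h (x, y)) (h (x', y')) < e"
  proof (intro allI impI)
    fix e :: real
    assume "e > 0"
    then obtain d where d: "d > 0" "\<And>z z'. dist z' z < d \<Longrightarrow> dist (h z') (h z) < e"
      using uc unfolding uniformly_continuous_on_def by (metis UNIV_I)
    have "dist (h (x, y)) (h (x', y')) < e" if "dist x x' + dist y y' < d" for x y x' y'
    proof (rule d(2))
      have "dist (x, y) (x', y') \<le> dist x x' + dist y y'"
        unfolding dist_Pair_Pair by (rule sqrt_sum_squares_le_sum) simp_all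
      with that show "dist (x, y) (x', y') < d" by simp
    qed
    with d(1) show "\<exists>d>0. \<forall>x y x' y'. dist x x' + dist y y' < d \<longrightarrow> dist (h (x, y)) (h (x', y')) < e"
      by blast
  qed
next
  assume sm: "\<forall>e>0. \<exists>d>0. \<forall>x y x' y'. dist x x' + dist y y' < d \<longrightarrow> dist (h (x, y)) (h (x', y')) < e"
  show "uniformly_continuous_on UNIV h"
    unfolding uniformly_continuous_on_def
  proof (intro allI impI)
    fix e :: real
    assume "e > 0"
    then obtain d where d: "d > 0"
      "\<And>x y x' y'. dist x x' + dist y y' < d \<Longrightarrow> dist (h (x, y)) (h (x', y')) < e"
      using sm by blast
    have "dist (h z') (h z) < e" if "dist z' z < d / 2" for z z'
    proof -
      have "dist (fst z') (fst z) + dist (snd z') (snd z) < d"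
        using dist_fst_le[of z' z] dist_snd_le[of z' z] that by linarith
      from d(2)[OF this] show ?thesis by simp
    qed
    with d(1) show "\<exists>d>0. \<forall>x\<in>UNIV. \<forall>x'\<in>UNIV. dist x' x < d \<longrightarrow> dist (h x') (h x) < e"
      by (intro exI[of _ "d / 2"]) simp
  qed
qed

end

theory Submission
  imports Defs "HOL-Library.Nat_Bijection" "HOL-Real_Asymp.Real_Asymp"
begin

text \<open>
  Let \<open>S\<close> be a uniformly random subset of \<open>{0..<m}\<close> and \<open>j\<close> an independent uniform element of
  \<open>{0..<m}\<close>. Take for \<open>X\<close> an integer encoding \<open>S\<close>, and \<open>Y = 2 * j + [j \<in> S]\<close>. Then \<open>Y\<close> is uniform
  on \<open>{0..<2 * m}\<close>, and the law of \<open>(X, Y)\<close> has a density with respect to the product of its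
  marginals that takes only the values 0 and 2.

  Rectangles do not see this dependence. The difference of the two laws on \<open>A \<times> B\<close> is the mean over
  \<open>S\<close> of \<open>a S * (\<Sum>j<m. c j * \<sigma> S j) / m\<close>, where \<open>a\<close> is an indicator, \<open>\<bar>c j\<bar> \<le> 1 / 2\<close>, and
  \<open>\<sigma> S j\<close> is \<open>1\<close> or \<open>-1\<close> according to whether \<open>j \<in> S\<close>. As functions of \<open>S\<close> the signs are
  orthonormal, so the Cauchy--Schwarz inequality (\<open>abs_sum_memb_sign_le\<close>) bounds the
  difference by \<open>1 / (2 * sqrt m)\<close>; this is \<open>memb_law_rectangle_discrepancy\<close>.

  A single Lipschitz function does see it. All values are integers, so the points that \<open>(X, Y)\<close>
  can take have distance at least 1 from all other integer points, and
  \<open>max 0 (1 - infdist z G)\<close>, with \<open>G\<close> the set of these points for all \<open>m\<close>, equals the indicator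
  of \<open>G\<close> at integer points. Its integral is 1 under the joint law and 1/2 under the product of
  the marginals, for every \<open>m\<close>.

  The pairs for \<open>m = 1, 2, 3, \<dots>\<close> live together on the product of their laws.
\<close>

section \<open>Orthogonality of the membership signs\<close>

text \<open>The sign \<open>\<sigma> S j\<close>: a Rademacher variable for each \<open>j\<close> when \<open>S\<close> is a random set.\<close>

definition memb_sign :: "nat set \<Rightarrow> nat \<Rightarrow> real" where
  "memb_sign S j = (if j \<in> S then 1 else -1)"

text \<open>Toggling the membership of \<open>j\<close> is an involution of the power set that flips the sign.\<close>

lemma sum_memb_sign_eq_0:
  assumes "finite J" "j \<in> J"
    and inv: "\<And>S. S \<subseteq> J \<Longrightarrow> f (sym_diff S {j}) = f S"
  shows "(\<Sum>S\<in>Pow J. memb_sign S j * f S) = 0"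
proof -
  have "(\<Sum>S\<in>Pow J. memb_sign S j * f S) = (\<Sum>S\<in>Pow J. - (memb_sign S j * f S))"
    by (rule sum.reindex_bij_witness[where i = "\<lambda>S. sym_diff S {j}" and j = "\<lambda>S. sym_diff S {j}"])
      (use assms(2) inv in \<open>auto simp: memb_sign_def\<close>)
  thus ?thesis
    by (simp add: sum_negf)
qed

lemma sum_memb_sign_mult:
  assumes "finite J" "i \<in> J" "j \<in> J"
  shows "(\<Sum>S\<in>Pow J. memb_sign S i * memb_sign S j) = (if i = j then 2 ^ card J else 0)"
proof (cases "i = j")
  case True
  have "(\<Sum>S\<in>Pow J. memb_sign S i * memb_sign S j) = (\<Sum>S\<in>Pow J. 1)"
    by (rule sum.cong) (auto simp: True memb_sign_def)
  thus ?thesis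
    using assms True by (simp add: card_Pow)
next
  case False
  have "(\<Sum>S\<in>Pow J. memb_sign S i * memb_sign S j) = 0"
    by (rule sum_memb_sign_eq_0) (use assms False in \<open>auto simp: memb_sign_def\<close>)
  thus ?thesis
    using False by simp
qed

text \<open>Parseval's identity for the orthogonal system of signs.\<close>

lemma sum_memb_sign_square:
  assumes "finite J"
  shows "(\<Sum>S\<in>Pow J. (\<Sum>j\<in>J. c j * memb_sign S j)\<^sup>2) = 2 ^ card J * (\<Sum>j\<in>J. (c j)\<^sup>2)"
proof -
  have "(\<Sum>S\<in>Pow J. (\<Sum>j\<in>J. c j * memb_sign S j)\<^sup>2)
      = (\<Sum>S\<in>Pow J. \<Sum>i\<in>J. \<Sum>j\<in>J. c i * c j * (memb_sign S i * memb_sign S j))"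
    by (simp add: power2_eq_square sum_product algebra_simps)
  also have "\<dots> = (\<Sum>i\<in>J. \<Sum>S\<in>Pow J. \<Sum>j\<in>J. c i * c j * (memb_sign S i * memb_sign S j))"
    by (rule sum.swap)
  also have "\<dots> = (\<Sum>i\<in>J. \<Sum>j\<in>J. \<Sum>S\<in>Pow J. c i * c j * (memb_sign S i * memb_sign S j))"
    by (rule sum.cong[OF refl]) (rule sum.swap)
  also have "\<dots> = (\<Sum>i\<in>J. \<Sum>j\<in>J. c i * c j * (if i = j then 2 ^ card J else 0))"
    by (intro sum.cong refl) (simp add: sum_distrib_left[symmetric] sum_memb_sign_mult assms)
  also have "\<dots> = (\<Sum>i\<in>J. 2 ^ card J * (c i)\<^sup>2)"
    by (intro sum.cong refl) (simp add: if_distrib assms power2_eq_square cong: if_cong)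
  finally show ?thesis
    by (simp add: sum_distrib_left)
qed

lemma abs_sum_memb_sign_le:
  assumes "finite J" and a: "\<And>S. \<bar>a S\<bar> \<le> 1"
  shows "\<bar>\<Sum>S\<in>Pow J. a S * (\<Sum>j\<in>J. c j * memb_sign S j)\<bar>
    \<le> 2 ^ card J * sqrt (\<Sum>j\<in>J. (c j)\<^sup>2)"
proof (subst power2_le_iff_abs_le[symmetric])
  show "0 \<le> 2 ^ card J * sqrt (\<Sum>j\<in>J. (c j)\<^sup>2)"
    by (simp add: sum_nonneg)
next
  let ?T = "\<lambda>S. \<Sum>j\<in>J. c j * memb_sign S j"
  have "(\<Sum>S\<in>Pow J. a S * ?T S)\<^sup>2 \<le> (\<Sum>S\<in>Pow J. (a S)\<^sup>2) * (\<Sum>S\<in>Pow J. (?T S)\<^sup>2)"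
    by (rule Cauchy_Schwarz_ineq_sum)
  also have "(\<Sum>S\<in>Pow J. (a S)\<^sup>2) \<le> (\<Sum>S\<in>Pow J. 1)"
    by (rule sum_mono) (use a in \<open>simp add: abs_square_le_1\<close>)
  hence "(\<Sum>S\<in>Pow J. (a S)\<^sup>2) * (\<Sum>S\<in>Pow J. (?T S)\<^sup>2)
      \<le> 2 ^ card J * (\<Sum>S\<in>Pow J. (?T S)\<^sup>2)"
    by (intro mult_right_mono sum_nonneg) (simp_all add: card_Pow assms)
  also have "\<dots> = (2 ^ card J * sqrt (\<Sum>j\<in>J. (c j)\<^sup>2))\<^sup>2"
    by (simp add: sum_memb_sign_square assms power_mult_distrib sum_nonneg)
      (simp add: power2_eq_square)
  finally show "(\<Sum>S\<in>Pow J. a S * ?T S)\<^sup>2 \<le> (2 ^ card J * sqrt (\<Sum>j\<in>J. (c j)\<^sup>2))\<^sup>2" .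
qed

section \<open>The joint law and its discrepancy on rectangles\<close>

text \<open>The value of \<open>Y\<close>: the pair of \<open>j\<close> and the truth value of \<open>j \<in> S\<close>, as an integer in
  \<open>{2 * j, 2 * j + 1}\<close>.\<close>

definition memb_code :: "nat set \<Rightarrow> nat \<Rightarrow> real" where
  "memb_code S j = real (2 * j + of_bool (j \<in> S))"

text \<open>The value of \<open>(X, Y)\<close>. The first coordinate determines \<open>S\<close> when \<open>S\<close> is finite.\<close>

definition memb_point :: "nat set \<Rightarrow> nat \<Rightarrow> real \<times> real" where
  "memb_point S j = (real (set_encode S), memb_code S j)"

text \<open>The law of \<open>(X, Y)\<close>. For \<open>m = 0\<close> the underlying set is empty and the law is
  unspecified.\<close>

definition memb_law :: "nat \<Rightarrow> (real \<times> real) pmf" where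
  "memb_law m = map_pmf (\<lambda>(S, j). memb_point S j) (pmf_of_set (Pow {..<m} \<times> {..<m}))"

lemma expectation_memb_law:
  fixes g :: "real \<times> real \<Rightarrow> real"
  assumes "m > 0"
  shows "measure_pmf.expectation (memb_law m) g
    = (\<Sum>S\<in>Pow {..<m}. \<Sum>j<m. g (memb_point S j)) / (2 ^ m * real m)"
proof -
  have "Pow {..<m} \<times> {..<m} \<noteq> {}"
    using assms by auto
  thus ?thesis
    unfolding memb_law_def
    by (simp add: integral_pmf_of_set card_Pow sum.cartesian_product case_prod_beta)
qed

lemma prob_memb_law:
  assumes "m > 0"
  shows "measure (memb_law m) C
    = (\<Sum>S\<in>Pow {..<m}. \<Sum>j<m. indicator C (memb_point S j)) / (2 ^ m * real m)"
  using expectation_memb_law[OF assms, of "indicator C"] by simp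

text \<open>A function of \<open>Y\<close>, for fixed \<open>j\<close>, is its average over the two possible values plus a
  multiple of the sign.\<close>

lemma memb_code_decomp:
  "g (memb_code S j) = (g (real (2 * j + 1)) + g (real (2 * j))) / 2
     + (g (real (2 * j + 1)) - g (real (2 * j))) / 2 * memb_sign S j" for g :: "real \<Rightarrow> real"
  by (simp add: memb_code_def memb_sign_def field_simps)

text \<open>The second marginal is uniform.\<close>

lemma sum_memb_code:
  fixes g :: "real \<Rightarrow> real"
  shows "(\<Sum>S\<in>Pow {..<m}. \<Sum>j<m. g (memb_code S j))
    = 2 ^ m * (\<Sum>j<m. (g (real (2 * j + 1)) + g (real (2 * j))) / 2)"
proof -
  have 0: "(\<Sum>S\<in>Pow {..<m}. memb_sign S j) = 0" if "j < m" for j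
    using sum_memb_sign_eq_0[of "{..<m}" j "\<lambda>_. 1"] that by simp
  have "(\<Sum>S\<in>Pow {..<m}. \<Sum>j<m. g (memb_code S j)) = (\<Sum>j<m. \<Sum>S\<in>Pow {..<m}. g (memb_code S j))"
    by (rule sum.swap)
  also have "\<dots> = (\<Sum>j<m. 2 ^ m * ((g (real (2 * j + 1)) + g (real (2 * j))) / 2))"
    by (intro sum.cong refl, subst memb_code_decomp)
      (simp add: sum.distrib sum_distrib_left[symmetric] 0 card_Pow
        del: times_divide_eq_left times_divide_eq_right)
  finally show ?thesis
    by (simp add: sum_distrib_left)
qed

lemma memb_law_rectangle_discrepancy:
  assumes m: "m > 0"
  shows "\<bar>measure (memb_law m) (A \<times> B)
      - measure (memb_law m) (fst -` A) * measure (memb_law m) (snd -` B)\<bar> \<le> 1 / (2 * sqrt m)"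
proof -
  define a where "a S = (indicator A (real (set_encode S)) :: real)" for S
  define b where "b = (indicator B :: real \<Rightarrow> real)"
  define d where "d j = (b (real (2 * j + 1)) + b (real (2 * j))) / 2" for j
  define c where "c j = (b (real (2 * j + 1)) - b (real (2 * j))) / 2" for j
  have b: "b (memb_code S j) = d j + c j * memb_sign S j" for S j
    unfolding c_def d_def by (rule memb_code_decomp)
  have joint: "measure (memb_law m) (A \<times> B)
      = (\<Sum>S\<in>Pow {..<m}. a S * (\<Sum>j<m. d j + c j * memb_sign S j)) / (2 ^ m * real m)"
    unfolding prob_memb_law[OF m]
    by (simp add: memb_point_def indicator_times a_def b[symmetric] b_def sum_distrib_left)
  have "measure (memb_law m) (fst -` A) = real m * (\<Sum>S\<in>Pow {..<m}. a S) / (2 ^ m * real m)"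
    unfolding prob_memb_law[OF m] indicator_vimage
    by (simp add: memb_point_def a_def sum_distrib_left)
  hence left: "measure (memb_law m) (fst -` A) = (\<Sum>S\<in>Pow {..<m}. a S) / 2 ^ m"
    using m by simp
  have "measure (memb_law m) (snd -` B) = 2 ^ m * (\<Sum>j<m. d j) / (2 ^ m * real m)"
    unfolding prob_memb_law[OF m] indicator_vimage
    using sum_memb_code[of b m] by (simp add: memb_point_def b_def d_def)
  hence right: "measure (memb_law m) (snd -` B) = (\<Sum>j<m. d j) / real m"
    by simp
  have "measure (memb_law m) (A \<times> B)
      - measure (memb_law m) (fst -` A) * measure (memb_law m) (snd -` B)
      = (\<Sum>S\<in>Pow {..<m}. a S * (\<Sum>j<m. c j * memb_sign S j)) / (2 ^ m * real m)"
    unfolding joint left right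
    by (simp add: sum.distrib distrib_left sum_distrib_right[symmetric] add_divide_distrib)
  also have "\<bar>\<dots>\<bar> \<le> (2 ^ m * sqrt (\<Sum>j<m. (c j)\<^sup>2)) / (2 ^ m * real m)"
    unfolding abs_divide
  proof (rule frac_le)
    show "\<bar>\<Sum>S\<in>Pow {..<m}. a S * (\<Sum>j<m. c j * memb_sign S j)\<bar>
        \<le> 2 ^ m * sqrt (\<Sum>j<m. (c j)\<^sup>2)"
      using abs_sum_memb_sign_le[of "{..<m}" a c] by (simp add: a_def)
  qed (use m in \<open>simp_all add: sum_nonneg\<close>)
  also have "\<dots> = sqrt (\<Sum>j<m. (c j)\<^sup>2) / real m"
    by simp
  also have "\<dots> \<le> sqrt (real m * (1 / 4)) / real m"
  proof (intro divide_right_mono real_sqrt_le_mono)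
    have "(\<Sum>j<m. (c j)\<^sup>2) \<le> (\<Sum>j<m. 1 / 4)"
      by (rule sum_mono) (simp add: c_def b_def indicator_def power2_eq_square)
    thus "(\<Sum>j<m. (c j)\<^sup>2) \<le> real m * (1 / 4)"
      by simp
  qed simp
  also have "\<dots> = 1 / (2 * sqrt m)"
    using m by (simp add: real_sqrt_divide field_simps)
  finally show ?thesis .
qed

section \<open>A Lipschitz function that detects the dependence\<close>

text \<open>All values of \<open>(X, Y)\<close>, for all \<open>m\<close> at once, so that one test function serves every
  \<open>m\<close>.\<close>

definition memb_graph :: "(real \<times> real) set" where
  "memb_graph = {memb_point S j | S j. finite S}"

text \<open>A Lipschitz function that agrees with the indicator of \<open>memb_graph\<close> at integer points.\<close>

definition memb_test :: "real \<times> real \<Rightarrow> real" where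
  "memb_test z = max 0 (1 - infdist z memb_graph)"

lemma memb_test_bounds: "0 \<le> memb_test z" "memb_test z \<le> 1"
  by (auto simp: memb_test_def infdist_nonneg)

lemma uniformly_continuous_memb_test: "uniformly_continuous_on UNIV memb_test"
  unfolding uniformly_continuous_on_def
proof (intro allI impI)
  fix e :: real
  assume "e > 0"
  have "dist (memb_test x') (memb_test x) \<le> dist x' x" for x x'
    using infdist_triangle_abs[of x' memb_graph x] unfolding memb_test_def dist_real_def by linarith
  with \<open>e > 0\<close> show "\<exists>d>0. \<forall>x\<in>UNIV. \<forall>x'\<in>UNIV. dist x' x < d \<longrightarrow> dist (memb_test x') (memb_test x) < e"
    by (meson le_less_trans)
qed

text \<open>At the integer point whose first coordinate encodes \<open>S\<close> and whose second coordinate is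
  \<open>2 * j + [j \<in> T]\<close>, the test function decides whether the sets \<open>S\<close> and \<open>T\<close> agree about
  \<open>j\<close>.\<close>

lemma memb_test_code:
  assumes "finite S"
  shows "memb_test (real (set_encode S), memb_code T j) = of_bool (j \<in> S \<longleftrightarrow> j \<in> T)"
proof (cases "j \<in> S \<longleftrightarrow> j \<in> T")
  case True
  hence "(real (set_encode S), memb_code T j) = memb_point S j"
    by (simp add: memb_point_def memb_code_def)
  hence "(real (set_encode S), memb_code T j) \<in> memb_graph"
    using assms unfolding memb_graph_def by blast
  thus ?thesis
    using True by (simp add: memb_test_def)
next
  case False
  let ?z = "(real (set_encode S), memb_code T j)"
  have nat_dist: "1 \<le> dist (real k) (real l)" if "k \<noteq> l" for k l
    using that by (simp add: dist_real_def)
  have far: "1 \<le> dist ?z w" if "w \<in> memb_graph" for w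
  proof -
    obtain S' j' where w: "w = memb_point S' j'" and "finite S'"
      using \<open>w \<in> memb_graph\<close> unfolding memb_graph_def by blast
    show ?thesis
    proof (cases "set_encode S = set_encode S'")
      case True
      hence "S = S'"
        using \<open>finite S\<close> \<open>finite S'\<close> by (simp add: set_encode_eq)
      have "2 * j + of_bool (j \<in> T) \<noteq> 2 * j' + of_bool (j' \<in> S')"
      proof
        assume eq: "2 * j + of_bool (j \<in> T) = 2 * j' + (of_bool (j' \<in> S') :: nat)"
        from arg_cong[OF eq, of "\<lambda>k. k div 2"] have "j = j'"
          by (auto split: if_splits)
        with eq False \<open>S = S'\<close> show False
          by (auto split: if_splits)
      qed
      from nat_dist[OF this] have "1 \<le> dist (snd ?z) (snd w)"
        by (simp add: w memb_point_def memb_code_def)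
      thus ?thesis
        using dist_snd_le[of ?z w] by linarith
    next
      case False
      from nat_dist[OF this] have "1 \<le> dist (fst ?z) (fst w)"
        by (simp add: w memb_point_def)
      thus ?thesis
        using dist_fst_le[of ?z w] by linarith
    qed
  qed
  have "memb_graph \<noteq> {}"
    unfolding memb_graph_def by blast
  hence "1 \<le> infdist ?z memb_graph"
    unfolding infdist_def by (auto intro!: cINF_greatest far)
  thus ?thesis
    using False by (simp add: memb_test_def)
qed

lemma expectation_memb_test_joint:
  assumes "m > 0"
  shows "measure_pmf.expectation (memb_law m) memb_test = 1"
proof -
  have "memb_test (memb_point S j) = 1" if "S \<subseteq> {..<m}" for S j
    using memb_test_code[of S S j] finite_subset[OF that] by (simp add: memb_point_def)
  thus ?thesis
    using assms by (simp add: expectation_memb_law card_Pow)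
qed

text \<open>For fixed \<open>S\<close>, exactly one of the two values \<open>2 * j\<close> and \<open>2 * j + 1\<close> of \<open>Y\<close> is
  detected.\<close>

lemma expectation_memb_test_column:
  assumes "m > 0" "finite S"
  shows "measure_pmf.expectation (memb_law m) (\<lambda>w. memb_test (real (set_encode S), snd w)) = 1 / 2"
proof -
  let ?g = "\<lambda>y. memb_test (real (set_encode S), y)"
  have "?g (real (2 * j + 1)) + ?g (real (2 * j)) = 1" for j
    \<comment> \<open>the sets \<open>{j}\<close> and \<open>{}\<close> realise the two codes \<open>2 * j + 1\<close> and \<open>2 * j\<close>\<close>
    using memb_test_code[OF assms(2), of "{j}" j] memb_test_code[OF assms(2), of "{}" j]
    by (simp add: memb_code_def)
  hence "(\<Sum>T\<in>Pow {..<m}. \<Sum>j<m. ?g (memb_code T j)) = 2 ^ m * (real m / 2)"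
    by (subst sum_memb_code) simp
  thus ?thesis
    using assms(1) by (simp add: expectation_memb_law memb_point_def)
qed

lemma expectation_memb_test_product:
  assumes m: "m > 0"
  shows "measure_pmf.expectation (memb_law m)
    (\<lambda>z. measure_pmf.expectation (memb_law m) (\<lambda>w. memb_test (fst z, snd w))) = 1 / 2"
proof -
  have "measure_pmf.expectation (memb_law m) (\<lambda>w. memb_test (fst (memb_point S j), snd w)) = 1 / 2"
    if "S \<subseteq> {..<m}" for S j
    using expectation_memb_test_column[OF m] finite_subset[OF that] by (simp add: memb_point_def)
  hence "(\<Sum>S\<in>Pow {..<m}. \<Sum>j<m. measure_pmf.expectation (memb_law m)
      (\<lambda>w. memb_test (fst (memb_point S j), snd w))) = (\<Sum>S\<in>Pow {..<m}. \<Sum>j<m. 1 / 2)"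
    by (intro sum.cong refl) simp
  thus ?thesis
    using m by (subst expectation_memb_law[OF m]) (simp add: card_Pow)
qed

section \<open>Realisation on a product space\<close>

lemma distr_PiM_pmf_component:
  fixes p :: "nat \<Rightarrow> 'a pmf"
  assumes "f \<in> UNIV \<rightarrow> space N"
  shows "distr (PiM UNIV (\<lambda>n. measure_pmf (p n))) N (\<lambda>\<omega>. f (\<omega> n)) = distr (measure_pmf (p n)) N f"
    (is "distr ?M _ _ = _")
proof -
  have "distr (measure_pmf (p n)) N f = distr (distr ?M (measure_pmf (p n)) (\<lambda>\<omega>. \<omega> n)) N f"
    by (subst distr_PiM_component) (simp_all add: prob_space_measure_pmf)
  also have "\<dots> = distr ?M N (f \<circ> (\<lambda>\<omega>. \<omega> n))"
    using assms by (intro distr_distr measurable_component_singleton) simp_all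
  finally show ?thesis
    by (simp add: comp_def)
qed

text \<open>Fubini's theorem, with both iterated integrals pulled back to the joint law.\<close>

lemma integral_product_of_marginals:
  fixes p :: "(real \<times> real) pmf" and h :: "real \<times> real \<Rightarrow> real"
  assumes [measurable]: "h \<in> borel_measurable borel" and h: "\<And>z. \<bar>h z\<bar> \<le> 1"
  shows "(\<integral>z. h z \<partial>(distr (measure_pmf p) borel fst \<Otimes>\<^sub>M distr (measure_pmf p) borel snd))
    = measure_pmf.expectation p (\<lambda>z. measure_pmf.expectation p (\<lambda>w. h (fst z, snd w)))"
proof -
  let ?P = "distr (measure_pmf p) borel fst" and ?Q = "distr (measure_pmf p) borel snd"
  interpret P: prob_space ?P
    by (rule measure_pmf.prob_space_distr) simp
  interpret Q: prob_space ?Q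
    by (rule measure_pmf.prob_space_distr) simp
  interpret PQ: pair_prob_space ?P ?Q ..
  have [measurable]: "h \<in> borel_measurable (borel \<Otimes>\<^sub>M borel)"
    by (simp add: borel_prod)
  have "integrable (?P \<Otimes>\<^sub>M ?Q) h"
    by (rule PQ.integrable_const_bound[where B = 1]) (simp_all add: h)
  hence "(\<integral>z. h z \<partial>(?P \<Otimes>\<^sub>M ?Q)) = (\<integral>x. \<integral>y. h (x, y) \<partial>?Q \<partial>?P)"
    by (rule PQ.integral_fst'[symmetric])
  also have "\<dots> = (\<integral>z. (\<integral>y. h (fst z, y) \<partial>?Q) \<partial>measure_pmf p)"
    by (rule integral_distr) (simp, measurable)
  also have "\<dots> = (\<integral>z. (\<integral>w. h (fst z, snd w) \<partial>measure_pmf p) \<partial>measure_pmf p)"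
    by (subst integral_distr) simp_all
  finally show ?thesis .
qed

theorem proposition9:
  "\<exists>(M :: (nat \<Rightarrow> real \<times> real) measure) (X :: nat \<Rightarrow> (nat \<Rightarrow> real \<times> real) \<Rightarrow> real) Y.
     prob_space M \<and> (\<forall>n. X n \<in> borel_measurable M) \<and> (\<forall>n. Y n \<in> borel_measurable M) \<and>
     AI3 M X Y \<and> \<not> AI1 M X Y"
proof -
  \<comment> \<open>the index is shifted because \<open>memb_law\<close> is meaningful only for \<open>m > 0\<close>\<close>
  define M where "M = PiM UNIV (\<lambda>n. measure_pmf (memb_law (Suc n)))"
  define X where "X n \<omega> = fst (\<omega> n)" for n and \<omega> :: "nat \<Rightarrow> real \<times> real"
  define Y where "Y n \<omega> = snd (\<omega> n)" for n and \<omega> :: "nat \<Rightarrow> real \<times> real"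
  have M: "prob_space M"
    unfolding M_def by (intro prob_space_PiM prob_space_measure_pmf)
  have coord: "(\<lambda>\<omega>. \<omega> n) \<in> measurable M (measure_pmf (memb_law (Suc n)))" for n
    unfolding M_def by (rule measurable_component_singleton) simp
  have X: "X n \<in> borel_measurable M" and Y: "Y n \<in> borel_measurable M" for n
    unfolding X_def Y_def by (rule measurable_compose[OF coord]; simp)+
  have XY: "distr M (borel \<Otimes>\<^sub>M borel) (\<lambda>\<omega>. (X n \<omega>, Y n \<omega>))
      = distr (measure_pmf (memb_law (Suc n))) borel (\<lambda>z. z)" for n
    unfolding M_def X_def Y_def borel_prod prod.collapse by (rule distr_PiM_pmf_component) simp
  have distr_X: "distr M borel (X n) = distr (measure_pmf (memb_law (Suc n))) borel fst"
    and distr_Y: "distr M borel (Y n) = distr (measure_pmf (memb_law (Suc n))) borel snd" for n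
    unfolding M_def X_def Y_def by (rule distr_PiM_pmf_component, simp)+
  have "AI3 M X Y"
    unfolding AI3_def
  proof (rule tendsto_sandwich)
    let ?D = "\<lambda>n (A, B). \<bar>measure (distr M (borel \<Otimes>\<^sub>M borel) (\<lambda>\<omega>. (X n \<omega>, Y n \<omega>))) (A \<times> B)
        - measure (distr M borel (X n)) A * measure (distr M borel (Y n)) B\<bar>"
    have D: "?D n (A, B) \<le> 1 / (2 * sqrt (real (Suc n)))"
      if "A \<in> sets borel" "B \<in> sets borel" for n A B
    proof -
      have "A \<times> B \<in> sets borel"
        using that by (simp add: borel_prod[symmetric])
      thus ?thesis
        using memb_law_rectangle_discrepancy[of "Suc n" A B] that
        unfolding XY distr_X distr_Y by (simp add: measure_distr)
    qed
    show "\<forall>\<^sub>F n in sequentially. (SUP z\<in>sets borel \<times> sets borel. ?D n z) \<le> 1 / (2 * sqrt (real (Suc n)))"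
    proof (intro always_eventually allI cSUP_least)
      show "sets borel \<times> sets borel \<noteq> ({} :: (real set \<times> real set) set)"
        by (auto intro: sets.top)
    qed (use D in auto)
    show "\<forall>\<^sub>F n in sequentially. 0 \<le> (SUP z\<in>sets borel \<times> sets borel. ?D n z)"
    proof (intro always_eventually allI)
      fix n
      have "?D n ({}, {}) \<le> (SUP z\<in>sets borel \<times> sets borel. ?D n z)"
        by (rule cSUP_upper) (use D in \<open>auto intro!: bdd_aboveI2\<close>)
      thus "0 \<le> (SUP z\<in>sets borel \<times> sets borel. ?D n z)"
        by simp
    qed
    show "(\<lambda>n. 1 / (2 * sqrt (real (Suc n)))) \<longlonglongrightarrow> 0"
      by real_asymp
  qed simp
  moreover have "\<not> AI1 M X Y"
  proof
    assume "AI1 M X Y"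
    moreover have "bounded (range memb_test)"
      using memb_test_bounds by (auto intro!: boundedI[where B = 1] simp: abs_of_nonneg)
    ultimately have lim: "(\<lambda>n. (\<integral>z. memb_test z \<partial>distr M (borel \<Otimes>\<^sub>M borel) (\<lambda>\<omega>. (X n \<omega>, Y n \<omega>)))
        - (\<integral>z. memb_test z \<partial>(distr M borel (X n) \<Otimes>\<^sub>M distr M borel (Y n)))) \<longlonglongrightarrow> 0"
      using uniformly_continuous_memb_test unfolding AI1_def by blast
    have meas: "memb_test \<in> borel_measurable borel"
      using uniformly_continuous_memb_test
      by (intro borel_measurable_continuous_onI uniformly_continuous_imp_continuous)
    have "(\<integral>z. memb_test z \<partial>distr M (borel \<Otimes>\<^sub>M borel) (\<lambda>\<omega>. (X n \<omega>, Y n \<omega>))) = 1" for n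
      unfolding XY using expectation_memb_test_joint[of "Suc n"]
      by (simp add: integral_distr meas)
    moreover have "(\<integral>z. memb_test z \<partial>(distr M borel (X n) \<Otimes>\<^sub>M distr M borel (Y n))) = 1 / 2" for n
      unfolding distr_X distr_Y
      by (subst integral_product_of_marginals[OF meas])
        (simp_all add: memb_test_bounds abs_of_nonneg expectation_memb_test_product)
    ultimately have "(\<lambda>n. 1 - 1 / 2 :: real) \<longlonglongrightarrow> 0"
      using lim by (simp only:)
    thus False
      by (simp add: LIMSEQ_const_iff)
  qed
  ultimately show ?thesis
    using M X Y by blast
qed

end
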